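(* Let $m\ge3$ be an integer and let $E(w)\in\mathbb Q[w]$ be the polynomial with $D(w)=E(w)^3$ if $3\nmid m$ and $D(w)=(w^2-\tfrac{27}{4})E(w)^3$ if $3\mid m$. Let $\mathcal E_m$ be the set of all distinct roots of $E$, each root $a$ having multiplicity $\mu(a)$. Then for every integer $n\ge1$, $$V_n(m)=\mathbf 1_{3\mid m}\cdot2\Big(\frac m3\Big)^{2n}+3\sum_{a\in\mathcal E_m}\mu(a)\left(\frac{3m^2}{4a^2}\right)^{n}.$$
   Context: For integers $n\ge1$, $m\ge3$, the $\mathrm{SU}(3)$ Verlinde sum is $$V_n(m)=3^nm^{2n}\sum_{\substack{(j,\ell,k)\in(\mathbb Z/m\mathbb Z\setminus\{0\})^3\\ j+\ell+k\equiv 0 \bmod m}}\Big(8\sin\frac{\pi j}{m}\sin\frac{\pi\ell}{m}\sin\frac{\pi k}{m}\Big)^{-2n}.$$ With $Q(u):=u^m-i^m$ and $W(u,v,w):=iu^2v^2+u^2v+uv^2-2wuv+u+v-i$ ($i=\sqrt{-1}$), $$D(w)=\frac{1}{2^{m^2}w^{3m-2}}\operatorname{Res}_u\Big(Q(u),\ \operatorname{Res}_v\big(Q(v),\,W(u,v,w)\big)\Big),$$ where $\operatorname{Res}_x$ is the resultant (Sylvester determinant) with respect to $x$. Equivalently, $D(w)=\prod(w-r_{a,b})$ over all $(a,b)\in(\mathbb Z/m\mathbb Z)^2$ with $a\ne0$, $b\ne0$, $a+b\not\equiv0 \bmod m$, where $r_{a,b}=-\sin\frac{2\pi a}{m}-\sin\frac{2\pi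 b}{m}+\sin\frac{2\pi(a+b)}{m}$. A polynomial $E$ as in the claim exists for every $m\geq 3$. $\mathbf 1_{3\mid m}$ equals $1$ if $3$ divides $m$ and $0$ otherwise. *)

theory Defs
  imports Complex_Main "Subresultants.Resultant_Prelim"
begin

text \<open>
  The nonzero residue classes mod \<open>m\<close> are represented by \<open>1, \<dots>, m - 1\<close>; another choice of
  representatives changes the product of sines at most by a sign, which the even power removes.
\<close>

definition verlinde_index :: "nat \<Rightarrow> (nat \<times> nat \<times> nat) set" where
  "verlinde_index m =
     {(j, l, k). j \<in> {1..<m} \<and> l \<in> {1..<m} \<and> k \<in> {1..<m} \<and> (j + l + k) mod m = 0}"

definition verlinde_sum :: "nat \<Rightarrow> nat \<Rightarrow> real" where
  "verlinde_sum n m = 3 ^ n * real m ^ (2 * n) *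
     (\<Sum>(j, l, k)\<in>verlinde_index m.
        (8 * sin (pi * real j / real m) * sin (pi * real l / real m) * sin (pi * real k / real m))
          powi (- 2 * int n))"

definition Q_poly :: "nat \<Rightarrow> complex poly" where
  "Q_poly m = monom 1 m - [:\<i> ^ m:]"

text \<open>
  \<open>W\<close> is an element of the ring \<open>((\<complex>[w])[u])[v]\<close>: \<open>v\<close> is the outermost and \<open>w\<close> the innermost
  indeterminate.
\<close>

definition W_poly :: "complex poly poly poly" where
  "W_poly =
     (let w = [:[:[:0, 1:]:]:]; u = [:[:0, 1:]:]; v = [:0, 1:]; c = [:[:[:\<i>:]:]:]
      in c * u^2 * v^2 + u^2 * v + u * v^2 - 2 * w * u * v + u + v - c)"

text \<open>
  The two copies of \<open>Q\<close> below are \<open>Q(v)\<close> in \<open>((\<complex>[w])[u])[v]\<close> and \<open>Q(u)\<close> in \<open>(\<complex>[w])[u]\<close>.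
\<close>

definition iterated_resultant :: "nat \<Rightarrow> complex poly" where
  "iterated_resultant m =
     resultant (map_poly (\<lambda>a. [:a:]) (Q_poly m))
       (resultant (map_poly (\<lambda>a. [:[:a:]:]) (Q_poly m)) W_poly)"

text \<open>
  The polynomial division is exact: the iterated resultant is
  \<open>\<Prod> 2 (w - r\<^sub>a\<^sub>b)\<close> over all \<open>(a, b)\<close> mod \<open>m\<close>, and \<open>r\<^sub>a\<^sub>b = 0\<close> holds precisely for the \<open>3 m - 2\<close>
  pairs with \<open>a = 0\<close>, \<open>b = 0\<close> or \<open>a + b = 0\<close>.
\<close>

definition D_poly :: "nat \<Rightarrow> complex poly" where
  "D_poly m = iterated_resultant m div monom (2 ^ (m ^ 2)) (3 * m - 2)"

end

theory Submission
  imports Defs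
begin

text \<open>
  Sum over the roots of \<open>D\<close>. Over an integral domain, a polynomial with distinct roots
  satisfies \<open>Res(f, g) = lc(f)\<^sup>d \<Prod> g(x)\<close> with \<open>d = deg g\<close>, as one sees by multiplying the
  Sylvester matrix by a matrix built from the Vandermonde matrix of the roots of \<open>f\<close>. At
  \<open>u = \<i> e\<^sup>2\<^sup>i\<^sup>s\<close>, \<open>v = \<i> e\<^sup>2\<^sup>i\<^sup>t\<close> the polynomial \<open>W\<close> is a unit multiple of
  \<open>2 (w + 4 sin s sin t sin (s + t))\<close>, so the nonzero roots of the iterated resultant are the
  \<open>r = - 4 sin(\<pi>a/m) sin(\<pi>b/m) sin(\<pi>(a+b)/m)\<close>. The summand of the Verlinde sum at
  \<open>(j, l, k) = (a, b, - a - b)\<close> is \<open>(4 r\<^sup>2)\<^sup>-\<^sup>n\<close>, hence \<open>V\<^sub>n(m)\<close> is the sum of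
  \<open>(3 m\<^sup>2 / (4 r\<^sup>2))\<^sup>n\<close> over the roots of \<open>D\<close>, with multiplicity.
\<close>

section \<open>Resultants with a polynomial that has distinct roots\<close>

text \<open>A kernel vector of the transpose is the coefficient list of a nonzero polynomial of
  degree below \<open>n\<close> that vanishes at \<open>n\<close> distinct points. The exponents
  descend to match the order of coefficients in the Sylvester matrix.\<close>

lemma det_vandermonde_nonzero:
  fixes xs :: "'a :: idom list"
  assumes "distinct xs"
  defines "n \<equiv> length xs"
  shows "det (mat n n (\<lambda>(i, j). (xs ! j) ^ (n - 1 - i))) \<noteq> 0"
proof
  define V where "V = mat n n (\<lambda>(i, j). (xs ! j) ^ (n - 1 - i))"
  assume "det (mat n n (\<lambda>(i, j). (xs ! j) ^ (n - 1 - i))) = 0"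
  then have "det (transpose_mat V) = 0"
    by (subst det_transpose[of _ n]) (auto simp: V_def)
  then obtain v where v: "v \<in> carrier_vec n" "v \<noteq> 0\<^sub>v n" "transpose_mat V *\<^sub>v v = 0\<^sub>v n"
    by (subst (asm) det_0_iff_vec_prod_zero[of _ n]) (auto simp: V_def)
  define p where "p = (\<Sum>t<n. monom (v $ t) (n - 1 - t))"
  have root: "poly p x = 0" if "x \<in> set xs" for x
  proof -
    from that obtain i where i: "i < n" "x = xs ! i"
      by (auto simp: in_set_conv_nth n_def)
    have "poly p x = (transpose_mat V *\<^sub>v v) $ i"
      using i v(1) by (auto simp: p_def V_def poly_sum poly_monom scalar_prod_def
          lessThan_atLeast0 mult.commute intro!: sum.cong)
    then show ?thesis using v i by simp
  qed
  have deg: "degree p \<le> n - 1"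
    unfolding p_def by (intro degree_sum_le) (auto intro: order.trans[OF degree_monom_le])
  obtain t where t: "t < n" "v $ t \<noteq> 0"
    using v(1,2) by (metis eq_vecI carrier_vecD index_zero_vec)
  have "coeff p (n - 1 - t) = (\<Sum>s<n. if s = t then v $ t else 0)"
    unfolding p_def coeff_sum using t by (intro sum.cong) auto
  then have "coeff p (n - 1 - t) \<noteq> 0"
    using t by simp
  then have "p \<noteq> 0" by auto
  then have "card {x. poly p x = 0} \<le> n - 1"
    using deg card_poly_roots_bound[of p] by linarith
  moreover have "card (set xs) \<le> card {x. poly p x = 0}"
    using \<open>p \<noteq> 0\<close> root by (intro card_mono poly_roots_finite) auto
  moreover have "card (set xs) = n"
    using assms by (simp add: distinct_card)
  ultimately show False using t by simp
qed

text \<open>Highest coefficients come first, as in a row of the Sylvester matrix, so this evaluates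
  such a row times a column of powers of \<open>x\<close>.\<close>

lemma poly_eq_sum_reverse:
  fixes q :: "'a :: comm_semiring_1 poly"
  assumes "q = 0 \<or> degree q < N"
  shows "(\<Sum>t<N. coeff q (N - 1 - t) * x ^ (N - 1 - t)) = poly q x"
proof -
  have "(\<Sum>t<N. coeff q (N - 1 - t) * x ^ (N - 1 - t)) = (\<Sum>t<N. coeff q t * x ^ t)"
    using sum.nat_diff_reindex[of "\<lambda>t. coeff q t * x ^ t" N] by simp
  also have "\<dots> = poly q x"
  proof (cases "q = 0")
    case False
    with assms have "degree q < N" by simp
    then show ?thesis
      unfolding poly_altdef by (intro sum.mono_neutral_right) (auto simp: coeff_eq_0)
  qed auto
  finally show ?thesis .
qed

text \<open>At a root \<open>x\<close> of \<open>f\<close>, the rows of \<open>S\<close> that come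
  from \<open>f\<close> give \<open>x^i * f(x) = 0\<close> and those from \<open>g\<close> give
  \<open>x^i * g(x)\<close>. Hence \<open>S * M\<close> is block lower triangular with diagonal
  blocks \<open>T\<close> and \<open>V * G\<close>, and determinants can be compared.\<close>

lemma resultant_by_distinct_roots:
  fixes f g :: "'a :: idom poly"
  assumes roots: "\<And>x. x \<in> A \<Longrightarrow> poly f x = 0" and card: "card A = degree f" and fin: "finite A"
  shows "resultant f g = lead_coeff f ^ degree g * (\<Prod>x\<in>A. poly g x)"
proof -
  define n k where "n = degree f" and "k = degree g"
  define N where "N = n + k"
  obtain xs where xs: "distinct xs" "set xs = A"
    using finite_distinct_list[OF fin] by blast
  have len: "length xs = n"
    using xs card distinct_card n_def by metis
  define S where "S = sylvester_mat f g"
  define V where "V = mat n n (\<lambda>(i, j). (xs ! j) ^ (n - 1 - i))"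
  define X where "X = mat k n (\<lambda>(i, j). (xs ! j) ^ (N - 1 - i))"
  \<comment> \<open>The identity block keeps the first \<open>k\<close> columns of \<open>S\<close>
    in the product and makes \<open>det M = det V\<close>.\<close>
  define M where "M = four_block_mat (1\<^sub>m k) X (0\<^sub>m n k) V"
  define G where "G = mat n n (\<lambda>(i, j). if i = j then poly g (xs ! i) else 0)"
  define T where "T = mat k k (\<lambda>(i, j). S $$ (i, j))"
  define C where "C = mat n k (\<lambda>(i, j). S $$ (i + k, j))"
  have S: "S \<in> carrier_mat N N" unfolding S_def N_def n_def k_def by auto
  have M: "M \<in> carrier_mat N N" unfolding M_def N_def X_def V_def by auto
  \<comment> \<open>Upper rows of \<open>S\<close> list the coefficients of shifted copies of
    \<open>f\<close>, lower rows those of shifted copies of \<open>g\<close>.\<close>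
  have S1: "S $$ (i, t) = coeff (monom 1 (k - 1 - i) * f) (N - 1 - t)"
    if "i < k" "t < N" for i t
    using that unfolding S_def
    by (subst sylvester_index_mat)
       (auto simp: N_def n_def k_def coeff_monom_mult intro!: coeff_eq_0 arg_cong[of _ _ "coeff f"])
  have S2: "S $$ (i + k, t) = coeff (monom 1 (n - 1 - i) * g) (N - 1 - t)"
    if "i < n" "t < N" for i t
    using that unfolding S_def
    by (subst sylvester_index_mat)
       (auto simp: N_def n_def k_def coeff_monom_mult intro!: coeff_eq_0 arg_cong[of _ _ "coeff g"])
  have Mc: "M $$ (t, j + k) = (xs ! j) ^ (N - 1 - t)" if "t < N" "j < n" for t j
    using that unfolding M_def X_def V_def N_def by (auto simp: Suc_diff_le)
  have Mc': "M $$ (t, j) = (if t = j then 1 else 0)" if "t < N" "j < k" for t j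
    using that unfolding M_def X_def V_def N_def by auto
  have SM: "(S * M) $$ (i, j) = (\<Sum>t<N. S $$ (i, t) * M $$ (t, j))" if "i < N" "j < N" for i j
    using that S M by (auto simp: scalar_prod_def lessThan_atLeast0)
  have SM1: "(S * M) $$ (i, j) = S $$ (i, j)" if "i < N" "j < k" for i j
  proof -
    have "(S * M) $$ (i, j) = (\<Sum>t<N. S $$ (i, t) * M $$ (t, j))"
      using that by (intro SM) (auto simp: N_def)
    also have "\<dots> = (\<Sum>t<N. if t = j then S $$ (i, j) else 0)"
      using that by (intro sum.cong refl) (simp add: Mc')
    finally have "(S * M) $$ (i, j) = (\<Sum>t<N. if t = j then S $$ (i, j) else 0)" .
    then show ?thesis using that by (simp add: N_def)
  qed
  have SM2: "(S * M) $$ (i, j + k) = 0" if "i < k" "j < n" for i j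
  proof -
    have "(S * M) $$ (i, j + k) =
        (\<Sum>t<N. coeff (monom 1 (k - 1 - i) * f) (N - 1 - t) * (xs ! j) ^ (N - 1 - t))"
      using that by (subst SM) (auto simp: N_def Mc S1[unfolded N_def] Mc[unfolded N_def])
    also have "\<dots> = poly (monom 1 (k - 1 - i) * f) (xs ! j)"
      using that
      by (intro poly_eq_sum_reverse, cases "f = 0")
         (auto simp: degree_mult_eq degree_monom_eq N_def n_def)
    also have "\<dots> = 0"
      using roots[of "xs ! j"] that len xs by (auto simp: poly_monom)
    finally show ?thesis .
  qed
  have SM3: "(S * M) $$ (i + k, j + k) = (V * G) $$ (i, j)" if "i < n" "j < n" for i j
  proof -
    have "(S * M) $$ (i + k, j + k) =
        (\<Sum>t<N. coeff (monom 1 (n - 1 - i) * g) (N - 1 - t) * (xs ! j) ^ (N - 1 - t))"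
      using that by (subst SM) (auto simp: N_def S2[unfolded N_def] Mc[unfolded N_def])
    also have "\<dots> = poly (monom 1 (n - 1 - i) * g) (xs ! j)"
      using that
      by (intro poly_eq_sum_reverse, cases "g = 0")
         (auto simp: degree_mult_eq degree_monom_eq N_def k_def)
    also have "\<dots> = (\<Sum>t<n. if t = j then (xs ! j) ^ (n - 1 - i) * poly g (xs ! j) else 0)"
      using that by (simp add: poly_monom)
    also have "\<dots> = (\<Sum>t<n. V $$ (i, t) * G $$ (t, j))"
      using that by (intro sum.cong refl) (simp add: V_def G_def)
    also have "\<dots> = (V * G) $$ (i, j)"
      using that by (simp add: V_def G_def scalar_prod_def lessThan_atLeast0)
    finally show ?thesis .
  qed
  have "S * M = four_block_mat T (0\<^sub>m k n) C (V * G)"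
  proof (rule eq_matI)
    fix i j assume "i < dim_row (four_block_mat T (0\<^sub>m k n) C (V * G))"
      and "j < dim_col (four_block_mat T (0\<^sub>m k n) C (V * G))"
    then have ij: "i < N" "j < N" by (auto simp: T_def V_def G_def N_def)
    consider "j < k" | j' where "i < k" "j = j' + k" "j' < n"
      | i' j' where "i = i' + k" "j = j' + k" "i' < n" "j' < n"
      using ij unfolding N_def
      by (metis less_diff_conv2 le_add_diff_inverse2 not_less)
    then show "(S * M) $$ (i, j) = four_block_mat T (0\<^sub>m k n) C (V * G) $$ (i, j)"
    proof cases
      case 1
      with ij show ?thesis
        by (subst SM1) (auto simp: T_def C_def V_def G_def N_def)
    next
      case 2
      then show ?thesis by (simp add: SM2 T_def V_def G_def)
    next
      case 3
      then show ?thesis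
        by (simp only: SM3) (simp add: T_def V_def G_def)
    qed
  qed (use S M in \<open>auto simp: T_def V_def G_def N_def\<close>)
  moreover have "det (four_block_mat T (0\<^sub>m k n) C (V * G)) = det T * det (V * G)"
    by (rule det_four_block_mat_upper_right_zero) (auto simp: T_def C_def V_def G_def)
  moreover have "det (V * G) = det V * det G"
    by (rule det_mult) (auto simp: V_def G_def)
  moreover have "det M = det V"
    unfolding M_def by (subst det_four_block_mat_lower_left_zero) (auto simp: X_def V_def)
  moreover have "det (S * M) = det S * det M"
    by (rule det_mult[OF S M])
  \<comment> \<open>The entry of \<open>T\<close> below the diagonal at \<open>(i, j)\<close> is the
    coefficient of \<open>f\<close> at \<open>n + i - j > n\<close>, hence zero; on the diagonal the
    index is \<open>n\<close>.\<close>
  moreover have "det T = lead_coeff f ^ k"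
  proof -
    have "det T = prod_list (diag_mat T)"
      by (rule det_upper_triangular[of _ k])
        (auto simp: upper_triangular_def T_def S1 N_def coeff_monom_mult n_def intro!: coeff_eq_0)
    also have "diag_mat T = map (\<lambda>i. lead_coeff f) [0..<k]"
      by (auto simp: diag_mat_def T_def S1 N_def coeff_monom_mult n_def
          intro!: arg_cong[of _ _ "coeff f"])
    finally show ?thesis by (simp add: map_replicate_const)
  qed
  moreover have "det G = (\<Prod>x\<in>A. poly g x)"
  proof -
    have "det G = prod_list (diag_mat G)"
      by (rule det_upper_triangular[of _ n]) (auto simp: upper_triangular_def G_def)
    also have "diag_mat G = map (\<lambda>i. poly g (xs ! i)) [0..<n]"
      by (auto simp: diag_mat_def G_def)
    also have "\<dots> = map (poly g) xs"
      using len by (intro nth_equalityI) auto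
    also have "prod_list \<dots> = (\<Prod>x\<in>A. poly g x)"
      using xs by (metis prod.distinct_set_conv_list)
    finally show ?thesis .
  qed
  moreover have "det V \<noteq> 0"
    using det_vandermonde_nonzero[OF xs(1)] len by (simp add: V_def)
  \<comment> \<open>In an integral domain the nonzero factor \<open>det V\<close> cancels without
    being inverted.\<close>
  ultimately have "det S * det V = (lead_coeff f ^ k * (\<Prod>x\<in>A. poly g x)) * det V"
    by (simp add: mult_ac)
  with \<open>det V \<noteq> 0\<close> show ?thesis
    by (simp add: resultant_def S_def k_def)
qed

section \<open>The iterated resultant as a product over the roots of \<open>Q\<close>\<close>

text \<open>\<open>Q\<close> is monic with \<open>m\<close> distinct roots, and the injective
  \<open>h\<close>, which embeds the constants into a polynomial ring, keeps them distinct.\<close>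

lemma resultant_Q_poly:
  fixes h :: "complex \<Rightarrow> 'a :: idom"
  assumes "inj_comm_ring_hom h" and "m > 0"
  shows "resultant (map_poly h (Q_poly m)) g = (\<Prod>z | z ^ m = \<i> ^ m. poly g (h z))"
proof -
  interpret inj_comm_ring_hom h by fact
  have deg: "degree (Q_poly m) = m"
    using assms(2) unfolding Q_poly_def diff_conv_add_uminus
    by (subst degree_add_eq_left) (auto simp: degree_monom_eq)
  have lead: "lead_coeff (map_poly h (Q_poly m)) = 1"
    using assms(2) deg by (simp add: coeff_map_poly Q_poly_def) (cases m; simp)
  have "resultant (map_poly h (Q_poly m)) g =
      lead_coeff (map_poly h (Q_poly m)) ^ degree g *
        (\<Prod>x\<in>h ` {z. z ^ m = \<i> ^ m}. poly g x)"
  proof (rule resultant_by_distinct_roots)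
    show "card (h ` {z. z ^ m = \<i> ^ m}) = degree (map_poly h (Q_poly m))"
      using assms(2) deg by (simp add: card_image inj_on_def card_nth_roots)
  qed (use assms(2) in \<open>auto simp: Q_poly_def poly_monom\<close>)
  also have "\<dots> = (\<Prod>z | z ^ m = \<i> ^ m. poly g (h z))"
    by (simp only: lead, subst prod.reindex) (auto simp: inj_on_def)
  finally show ?thesis .
qed

text \<open>The inner resultant substitutes \<open>v = y\<close>, the outer one
  \<open>u = x\<close>; evaluation at \<open>u = x\<close> commutes with the inner product. Each
  factor is a polynomial in \<open>w\<close>.\<close>

lemma iterated_resultant_eq_prod:
  assumes "m > 0"
  shows "iterated_resultant m =
    (\<Prod>x | x ^ m = \<i> ^ m. \<Prod>y | y ^ m = \<i> ^ m. poly (poly W_poly [:[:y:]:]) [:x:])"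
proof -
  have "inj_comm_ring_hom (\<lambda>a :: complex. [:a:])"
    by unfold_locales (auto simp: one_pCons)
  moreover have "inj_comm_ring_hom (\<lambda>a :: complex. [:[:a:]:])"
    by unfold_locales (auto simp: one_pCons)
  ultimately show ?thesis
    using assms by (simp add: iterated_resultant_def resultant_Q_poly poly_prod)
qed

section \<open>Factorization of \<open>W\<close> and the sine roots\<close>

text \<open>This is \<open>r_{a,b}\<close> in product form, which exposes its zeros and its relation
  to the Verlinde summand.\<close>

definition sine_root :: "nat \<Rightarrow> nat \<Rightarrow> nat \<Rightarrow> real" where
  "sine_root m a b = - 4 * sin (pi * a / m) * sin (pi * b / m) * sin (pi * (a + b) / m)"

lemma four_sin_product:
  fixes x y :: real
  shows "4 * sin x * sin y * sin (x + y) = sin (2 * x) + sin (2 * y) - sin (2 * (x + y))"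
proof -
  \<comment> \<open>Here \<open>a\<close>, \<open>c\<close> stand for the sine and cosine of
    \<open>x\<close>, and \<open>b\<close>, \<open>d\<close> for those of \<open>y\<close>.\<close>
  have "4 * a * b * (a * d + c * b) =
      2 * (a * c) + 2 * (b * d) - 2 * ((a * d + c * b) * (c * d - a * b))"
    if "a\<^sup>2 + c\<^sup>2 = 1" "b\<^sup>2 + d\<^sup>2 = 1" for a b c d :: real
  proof -
    have sq: "1 - d * d = b * b" "1 - c * c = a * a"
      using that by (simp_all add: power2_eq_square algebra_simps)
    have "2 * (a * c) + 2 * (b * d) - 2 * ((a * d + c * b) * (c * d - a * b)) =
        2 * a * c * (1 - d * d) + 2 * b * d * (1 - c * c) + 2 * a * a * b * d + 2 * a * b * b * c"
      by (simp add: algebra_simps)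
    also have "\<dots> = 4 * a * b * (a * d + c * b)"
      unfolding sq by (simp add: algebra_simps)
    finally show ?thesis ..
  qed
  from this[OF sin_cos_squared_add[of x] sin_cos_squared_add[of y]] show ?thesis
    unfolding sin_double by (simp add: sin_add cos_add mult.assoc)
qed

text \<open>With \<open>u = \<i> * x\<close> and \<open>v = \<i> * y\<close>, \<open>W\<close> is
  linear in \<open>w\<close> with leading coefficient \<open>2 * x * y\<close>. Its constant term is
  found by writing the sines of doubled angles through \<open>x\<close>, \<open>y\<close> and their
  inverses.\<close>

lemma W_poly_factor:
  fixes s t :: real
  shows "poly (poly W_poly [:[:\<i> * cis (2 * t):]:]) [:\<i> * cis (2 * s):] =
    smult (2 * cis (2 * s) * cis (2 * t)) [:of_real (4 * sin s * sin t * sin (s + t)), 1:]"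
proof -
  define x y where "x = cis (2 * s)" and "y = cis (2 * t)"
  have nz: "x \<noteq> 0" "y \<noteq> 0" by (auto simp: x_def y_def)
  have sin_cis: "complex_of_real (sin u) = (cis u - inverse (cis u)) / (2 * \<i>)" for u
    by (simp add: complex_eq_iff)
  define r where "r = complex_of_real (4 * sin s * sin t * sin (s + t))"
  have "2 * \<i> * r = (x - inverse x) + (y - inverse y) - (x * y - inverse (x * y))"
    unfolding r_def four_sin_product of_real_add of_real_diff sin_cis x_def y_def cis_mult
    by (simp add: field_simps)
  moreover have "x * y * ((x - inverse x) + (y - inverse y) - (x * y - inverse (x * y))) =
      x * x * y + x * y * y - x * x * y * y - x - y + 1"
    using nz by (simp add: field_simps)
  ultimately have "x * y * (2 * \<i> * r) = x * x * y + x * y * y - x * x * y * y - x - y + 1"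
    by simp
  moreover have "2 * x * y * r = - \<i> * (x * y * (2 * \<i> * r))"
    by simp
  \<comment> \<open>The right-hand side is the constant term in \<open>w\<close> of \<open>W\<close>
    at this point.\<close>
  ultimately have "2 * x * y * r = - \<i> * (x * x * y + x * y * y - x * x * y * y - x - y + 1)"
    by simp
  then show ?thesis
    unfolding x_def[symmetric] y_def[symmetric] r_def[symmetric]
    by (simp add: W_poly_def Let_def numeral_poly power2_eq_square algebra_simps)
qed

text \<open>The roots of \<open>Q\<close> are \<open>\<i>\<close> times the \<open>m\<close>-th
  roots of unity, so the factorization of \<open>W\<close> applies with
  \<open>s = pi * a / m\<close> and \<open>t = pi * b / m\<close>.\<close>

lemma iterated_resultant_eq_sine_roots:
  assumes m: "m > 0"
  shows "iterated_resultant m = smult (2 ^ m\<^sup>2)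
    (\<Prod>(a, b)\<in>{..<m} \<times> {..<m}. [:- of_real (sine_root m a b), 1:])"
proof -
  define z where "z = (\<lambda>k. cis (2 * (pi * real k / real m)))"
  have bij: "bij_betw z {..<m} {x. x ^ m = 1}"
    using bij_betw_roots_unity[OF m] by (simp add: z_def mult.assoc)
  have "bij_betw (\<lambda>x. \<i> * x) {x. x ^ m = 1} {x. x ^ m = \<i> ^ m}"
    by (rule bij_betw_byWitness[where f' = "\<lambda>x. x / \<i>"])
      (auto simp: power_mult_distrib power_divide simp del: divide_i)
  from bij_betw_trans[OF bij this] have bij': "bij_betw (\<lambda>k. \<i> * z k) {..<m} {x. x ^ m = \<i> ^ m}"
    by (simp add: o_def)
  have "iterated_resultant m =
      (\<Prod>a<m. \<Prod>b<m. smult (2 * z a * z b) [:- of_real (sine_root m a b), 1:])"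
    unfolding iterated_resultant_eq_prod[OF m]
  proof (subst prod.reindex_bij_betw[OF bij', symmetric], rule prod.cong[OF refl],
      subst prod.reindex_bij_betw[OF bij', symmetric], rule prod.cong[OF refl])
    fix a b
    show "poly (poly W_poly [:[:\<i> * z b:]:]) [:\<i> * z a:] =
        smult (2 * z a * z b) [:- of_real (sine_root m a b), 1:]"
      unfolding z_def W_poly_factor sine_root_def by (simp add: add_divide_distrib distrib_left)
  qed
  also have "\<dots> = smult (\<Prod>a<m. \<Prod>b<m. 2 * z a * z b)
      (\<Prod>a<m. \<Prod>b<m. [:- of_real (sine_root m a b), 1:])"
    by (simp only: prod_smult)
  \<comment> \<open>Each root of unity occurs to a power divisible by \<open>m\<close>, so only the
    \<open>m^2\<close> factors 2 survive.\<close>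
  also have "(\<Prod>a<m. \<Prod>b<m. 2 * z a * z b) = 2 ^ m\<^sup>2 * ((\<Prod>a<m. z a) ^ m * (\<Prod>b<m. z b) ^ m)"
    by (simp add: prod.distrib power2_eq_square power_mult prod_power_distrib mult.assoc)
  also have "(\<Prod>a<m. z a) ^ m = 1"
    unfolding prod_power_distrib using bij_betwE[OF bij] by (intro prod.neutral) auto
  finally show ?thesis
    by (simp add: prod.cartesian_product)
qed

section \<open>Vanishing sine roots and the roots of \<open>D\<close>\<close>

text \<open>For \<open>k < 2 * m\<close>, a range that includes \<open>a + b\<close>, the sine of
  \<open>pi * k / m\<close> vanishes only at \<open>k = 0\<close> and \<open>k = m\<close>.\<close>

lemma sine_root_zero_pairs:
  assumes "m > 0"
  shows "{(a, b) \<in> {..<m} \<times> {..<m}. sine_root m a b \<noteq> 0} =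
      {(a, b) \<in> {1..<m} \<times> {1..<m}. a + b \<noteq> m}" (is ?nonzero)
    and "card {(a, b) \<in> {..<m} \<times> {..<m}. sine_root m a b = 0} = 3 * m - 2" (is ?card)
proof -
  have sin_zero: "sin (pi * real k / real m) = 0 \<longleftrightarrow> k = 0 \<or> k = m" if "k < 2 * m" for k
  proof
    assume "sin (pi * real k / real m) = 0"
    then obtain i :: int where "pi * real k / real m = of_int i * pi"
      by (auto simp: sin_zero_iff_int2)
    then have "real k = of_int (i * int m)"
      using assms by (simp add: field_simps)
    then have k: "int k = i * int m"
      by (metis of_int_eq_iff of_int_of_nat_eq)
    have "i \<ge> 0" using k assms by (metis mult_neg_pos not_less of_nat_0_le_iff of_nat_0_less_iff)
    moreover have "i < 2" 
      using k that assms mult_right_mono[of 2 i "int m"] by linarith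
    ultimately have "i = 0 \<or> i = 1" by linarith
    with k show "k = 0 \<or> k = m" by auto
  qed (use assms in auto)
  have zero: "sine_root m a b = 0 \<longleftrightarrow> a = 0 \<or> b = 0 \<or> a + b = m" if "a < m" "b < m" for a b
    using sin_zero[of a] sin_zero[of b] sin_zero[of "a + b"] that by (auto simp: sine_root_def)
  then show ?nonzero by auto
  \<comment> \<open>The three pieces are disjoint: the pair \<open>(0, 0)\<close> is counted in the
    first only.\<close>
  have "{(a, b) \<in> {..<m} \<times> {..<m}. sine_root m a b = 0} =
      {0} \<times> {..<m} \<union> {1..<m} \<times> {0} \<union> (\<lambda>a. (a, m - a)) ` {1..<m}"
    using zero assms by (auto simp: image_iff)
  also have "card \<dots> = m + (m - 1) + (m - 1)"
    by (subst card_Un_disjoint card_image; (subst card_Un_disjoint)?) (auto simp: inj_on_def card_image)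
  finally show ?card using assms by simp
qed

text \<open>The \<open>3 * m - 2\<close> zero roots contribute a power of \<open>w\<close> which,
  with the constant \<open>2 ^ m^2\<close>, is exactly the divisor in \<open>D_poly\<close>.\<close>

lemma D_poly_eq_prod:
  assumes "m > 0"
  shows "D_poly m = (\<Prod>(a, b)\<in>{(a, b) \<in> {1..<m} \<times> {1..<m}. a + b \<noteq> m}.
    [:- of_real (sine_root m a b), 1:])"
proof -
  define L where "L = (\<lambda>(a, b). [:- complex_of_real (sine_root m a b), 1:])"
  define P where "P = {..<m} \<times> {..<m}"
  define Z where "Z = {(a, b) \<in> P. sine_root m a b = 0}"
  define G where "G = {(a, b) \<in> P. sine_root m a b \<noteq> 0}"
  have PZG: "P = Z \<union> G" "Z \<inter> G = {}"
    by (auto simp: Z_def G_def)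
  moreover have "finite P"
    by (simp add: P_def)
  ultimately have fin: "finite Z" "finite G"
    by simp_all
  have "prod L P = prod L Z * prod L G"
    using PZG fin by (simp add: prod.union_disjoint)
  also have "prod L Z = (\<Prod>_\<in>Z. monom 1 1)"
    by (intro prod.cong) (auto simp: L_def Z_def monom_altdef)
  also have "\<dots> = monom 1 (3 * m - 2)"
    using sine_root_zero_pairs(2)[OF assms] by (simp add: Z_def P_def monom_power)
  finally have P: "prod L P = monom 1 (3 * m - 2) * prod L G" .
  have "iterated_resultant m = smult (2 ^ m\<^sup>2) (prod L P)"
    using iterated_resultant_eq_sine_roots[OF assms] by (simp add: L_def P_def)
  also have "\<dots> = monom (2 ^ m\<^sup>2) (3 * m - 2) * prod L G"
    unfolding P mult_smult_left[symmetric] smult_monom by simp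
  finally have "D_poly m = prod L G"
    unfolding D_poly_def by simp
  then show ?thesis
    using sine_root_zero_pairs(1)[OF assms] by (simp add: L_def G_def P_def)
qed

section \<open>Sums over roots and the Verlinde sum\<close>

text \<open>Serves to pass from the multiset \<open>proots\<close> to distinct roots weighted by
  their order.\<close>

lemma sum_mset_image_multiplicity:
  fixes f :: "'a \<Rightarrow> 'b :: comm_semiring_1"
  shows "(\<Sum>x\<in>#M. f x) = (\<Sum>x\<in>set_mset M. of_nat (count M x) * f x)"
proof (induction M)
  case (add y M)
  have "(\<Sum>x\<in>set_mset (add_mset y M). of_nat (count (add_mset y M) x) * f x) =
      (\<Sum>x\<in>insert y (set_mset M). (if x = y then f x else 0) + of_nat (count M x) * f x)"
    by (intro sum.cong) (auto simp: algebra_simps)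
  also have "\<dots> = f y + (\<Sum>x\<in>insert y (set_mset M). of_nat (count M x) * f x)"
    by (simp add: sum.distrib)
  also have "(\<Sum>x\<in>insert y (set_mset M). of_nat (count M x) * f x) =
      (\<Sum>x\<in>set_mset M. of_nat (count M x) * f x)"
    by (intro sum.mono_neutral_right) (auto simp: not_in_iff)
  finally show ?case using add.IH by simp
qed auto

text \<open>The residue \<open>k\<close> is determined by \<open>a\<close> and \<open>b\<close>, and
  it is nonzero exactly when \<open>a + b \<noteq> m\<close>. Its sine agrees up to sign with that
  of \<open>a + b\<close>, and the even power removes the sign.\<close>

lemma verlinde_sum_eq_sine_roots:
  assumes "m > 0"
  shows "verlinde_sum n m = (\<Sum>(a, b)\<in>{(a, b) \<in> {1..<m} \<times> {1..<m}. a + b \<noteq> m}.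
    (3 * real m ^ 2 / (4 * (sine_root m a b)\<^sup>2)) ^ n)"
proof -
  have index: "a + b \<noteq> m \<and> (a + b + k = m \<or> a + b + k = 2 * m)"
    if "(a, b, k) \<in> verlinde_index m" for a b k
  proof -
    have bds: "a \<in> {1..<m}" "b \<in> {1..<m}" "k \<in> {1..<m}" and "(a + b + k) mod m = 0"
      using that by (auto simp: verlinde_index_def)
    then obtain q where q: "a + b + k = m * q" by (auto simp: mod_eq_0_iff_dvd)
    have "m * q < m * 3" using bds unfolding q[symmetric] by auto
    then have "q < 3" by simp
    moreover have "q \<noteq> 0" using bds q by (intro notI) simp
    ultimately have "q = 1 \<or> q = 2" by auto
    with q bds show ?thesis by auto
  qed
  have "verlinde_sum n m = (\<Sum>(j, l, k)\<in>verlinde_index m. 3 ^ n * real m ^ (2 * n) *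
      (8 * sin (pi * real j / real m) * sin (pi * real l / real m) * sin (pi * real k / real m))
        powi (- 2 * int n))"
    unfolding verlinde_sum_def sum_distrib_left by (intro sum.cong) auto
  also have "\<dots> = (\<Sum>(a, b)\<in>{(a, b) \<in> {1..<m} \<times> {1..<m}. a + b \<noteq> m}.
    (3 * real m ^ 2 / (4 * (sine_root m a b)\<^sup>2)) ^ n)"
  \<comment> \<open>Since \<open>0 < j + l + k < 3 * m\<close>, the sum is \<open>m\<close> or
    \<open>2 * m\<close>; the size of \<open>a + b\<close> decides which.\<close>
  proof (rule sum.reindex_bij_witness[where j = "\<lambda>(j, l, k). (j, l)"
        and i = "\<lambda>(a, b). (a, b, if a + b < m then m - (a + b) else 2 * m - (a + b))"], goal_cases)
    case (1 x)
    obtain a b k where "x = (a, b, k)" by (cases x)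
    with 1 index[of a b k] show ?case by (auto simp: verlinde_index_def)
  next
    case (2 x)
    obtain a b k where "x = (a, b, k)" by (cases x)
    with 2 index[of a b k] show ?case by (auto simp: verlinde_index_def)
  next
    case (3 x)
    then show ?case by auto
  next
    case (4 x)
    then show ?case by (auto simp: verlinde_index_def)
  next
    case (5 x)
    obtain a b k where x: "x = (a, b, k)" by (cases x)
    let ?s = "\<lambda>j :: nat. sin (pi * real j / real m)"
    from 5 x index[of a b k] have "a + b + k = m \<or> a + b + k = 2 * m" by auto
    then have "(?s k)\<^sup>2 = (?s (a + b))\<^sup>2"
    proof
      assume "a + b + k = m"
      then have k: "real k = real m - real (a + b)" by linarith
      have "pi * real k / real m = pi - pi * real (a + b) / real m"
        unfolding k using assms by (simp add: right_diff_distrib diff_divide_distrib)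
      then show ?thesis by (simp only: sin_pi_minus)
    next
      assume "a + b + k = 2 * m"
      then have k: "real k = 2 * real m - real (a + b)" by linarith
      have "pi * real k / real m = 2 * pi - pi * real (a + b) / real m"
        unfolding k using assms by (simp add: right_diff_distrib diff_divide_distrib)
      then show ?thesis by (simp only: sin_2pi_minus power2_minus)
    qed
    then have sq: "(8 * ?s a * ?s b * ?s k)\<^sup>2 = 4 * (sine_root m a b)\<^sup>2"
      by (simp add: sine_root_def power_mult_distrib)
    have "(8 * ?s a * ?s b * ?s k) powi (- 2 * int n) = inverse ((8 * ?s a * ?s b * ?s k) powi int (2 * n))"
      by (simp flip: power_int_minus)
    also have "\<dots> = inverse (4 * (sine_root m a b)\<^sup>2) ^ n"
      by (simp only: power_int_of_nat power_mult sq power_inverse)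
    finally have "3 ^ n * real m ^ (2 * n) * (8 * ?s a * ?s b * ?s k) powi (- 2 * int n) =
        (3 * real m ^ 2 / (4 * (sine_root m a b)\<^sup>2)) ^ n"
      by (simp only: power_mult divide_inverse power_mult_distrib)
    then show ?case by (simp only: x prod.case)
  qed
  finally show ?thesis .
qed

section \<open>From the roots of \<open>D\<close> to those of \<open>E\<close>\<close>

theorem theorem1p4:
  fixes m :: nat and E :: "rat poly" and E' :: "complex poly"
  defines "E' \<equiv> map_poly of_rat E"
  assumes "m \<ge> 3"
    and "\<not> 3 dvd m \<Longrightarrow> D_poly m = E' ^ 3"
    and "3 dvd m \<Longrightarrow> D_poly m = [:- (27 / 4), 0, 1:] * E' ^ 3"
  shows "\<forall>n\<ge>1. complex_of_real (verlinde_sum n m) =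
    of_bool (3 dvd m) * 2 * (of_nat m / 3) ^ (2 * n) +
    3 * (\<Sum>a\<in>{a. poly E' a = 0}. of_nat (order a E') * (3 * of_nat m ^ 2 / (4 * a ^ 2)) ^ n)"
proof (intro allI impI)
  fix n :: nat
  define f :: "complex \<Rightarrow> complex" where "f = (\<lambda>a. (3 * of_nat m ^ 2 / (4 * a ^ 2)) ^ n)"
  define G where "G = {(a, b) \<in> {1..<m} \<times> {1..<m}. a + b \<noteq> m}"
  define r where "r = (\<lambda>(a, b). complex_of_real (sine_root m a b))"
  have m: "m > 0" using assms(2) by simp
  have fin: "finite G"
    unfolding G_def by (rule finite_subset[of _ "{1..<m} \<times> {1..<m}"]) auto
  have D: "D_poly m = (\<Prod>g\<in>G. [:- r g, 1:])"
    unfolding D_poly_eq_prod[OF m] G_def r_def by (intro prod.cong) auto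
  \<comment> \<open>Nonvanishing of \<open>D\<close> and \<open>E'\<close> lets root multisets add
    over products.\<close>
  have D0: "D_poly m \<noteq> 0"
    unfolding D using fin by simp
  then have E0: "E' \<noteq> 0"
    using assms(3,4) by (cases "3 dvd m") auto
  \<comment> \<open>Distinct pairs may share a root, so the roots are collected with
    repetition.\<close>
  have "proots (D_poly m) = (\<Sum>g\<in>G. {#r g#})"
    unfolding D by (subst proots_prod) auto
  moreover have "(\<Sum>a\<in>#(\<Sum>g\<in>G. {#r g#}). f a) = (\<Sum>g\<in>G. f (r g))"
    using fin by (induction G rule: finite_induct) auto
  ultimately have "(\<Sum>a\<in>#proots (D_poly m). f a) = (\<Sum>g\<in>G. f (r g))"
    by simp
  also have "\<dots> = complex_of_real (verlinde_sum n m)"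
    unfolding verlinde_sum_eq_sine_roots[OF m] G_def of_real_sum
    by (intro sum.cong) (auto simp: f_def r_def)
  finally have V: "complex_of_real (verlinde_sum n m) = (\<Sum>a\<in>#proots (D_poly m). f a)" ..
  \<comment> \<open>The cube triples the root multiset of \<open>E'\<close>, which gives the factor
    3.\<close>
  have E: "(\<Sum>a\<in>#proots (E' ^ 3). f a) = 3 * (\<Sum>a\<in>{a. poly E' a = 0}. of_nat (order a E') * f a)"
    using E0 by (simp add: power3_eq_cube proots_mult sum_mset_image_multiplicity)
  show "complex_of_real (verlinde_sum n m) =
    of_bool (3 dvd m) * 2 * (of_nat m / 3) ^ (2 * n) +
    3 * (\<Sum>a\<in>{a. poly E' a = 0}. of_nat (order a E') * (3 * of_nat m ^ 2 / (4 * a ^ 2)) ^ n)"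
  proof (cases "3 dvd m")
    case False
    with assms(3) V E show ?thesis by (simp add: f_def)
  next
    case True
    \<comment> \<open>The extra quadratic factor has the roots \<open>s\<close> and
      \<open>- s\<close>; each contributes \<open>(m / 3) ^ (2 * n)\<close>, whence the coefficient
      2.\<close>
    define s where "s = complex_of_real (sqrt (27 / 4))"
    have s2: "s\<^sup>2 = 27 / 4"
      unfolding s_def of_real_power[symmetric] by simp
    have quad: "[:- (27 / 4), 0, 1:] = [:- s, 1:] * [:s, 1:]"
      using s2 by (simp add: power2_eq_square)
    have "3 * of_nat m ^ 2 / (4 * s\<^sup>2) = (of_nat m / 3)\<^sup>2"
      unfolding s2 by (simp add: power_divide)
    then have fs: "f s = (of_nat m / 3) ^ (2 * n)" "f (- s) = (of_nat m / 3) ^ (2 * n)"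
      by (simp_all add: f_def power_mult)
    have "proots (D_poly m) = proots ([:- s, 1:] * [:s, 1:]) + proots (E' ^ 3)"
      unfolding assms(4)[OF True] quad using E0 by (intro proots_mult) auto
    also have "proots ([:- s, 1:] * [:s, 1:]) = {#s#} + {#- s#}"
      by (subst proots_mult) auto
    finally show ?thesis
      using True V E fs by (simp add: f_def)
  qed
qed

end
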